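(* For every $n\in\mathbb{N}$, the monoid $\mathcal{M}_n$ is cancellative.
   Context: $\mathbb{N}$ denotes the set of positive integers. For $n\in\mathbb{N}$, let $X_n=\{a,b,c,d,A_1,\dots,A_n,B_1,\dots,B_n,C_1,\dots,C_n,D_1,\dots,D_n\}$ be an alphabet of $4n+4$ distinct letters, and let $\mathcal{M}_n$ be the monoid with monoid presentation $\langle X_n \mid \rho_n\rangle$, where $\rho_n$ consists of the following relations (a pair $(w_1,w_2)$ means the relation $w_1=w_2$): $(da,\,A_1C_1)$; $(A_iD_i,\,A_{i+1}C_{i+1})$ for $1\le i\le n-1$; $(A_nD_n,\,db)$; $(cb,\,B_nD_n)$; $(B_iC_i,\,B_{i-1}D_{i-1})$ for $2\le i\le n$. (For $n=1$ the relations are $(da,A_1C_1)$, $(A_1D_1,db)$, $(cb,B_1D_1)$.) That is, $\mathcal{M}_n$ is the quotient of the free monoid $X_n^*$ by the congruence generated by $\rho_n$. A monoid $M$ is left cancellative if $xy=xz$ implies $y=z$ for all $x,y,z\in M$, right cancellative if $yx=zx$ implies $y=z$ for all $x,y,z\in M$, and cancellative if it is both. *)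

theory Defs
  imports "HOL-Algebra.Divisibility"
begin

text \<open>Monoid presentations. Words over an alphabet \<open>X\<close> are the elements of \<open>lists X\<close>;
  \<open>pres_cong X R\<close> is the least congruence on the free monoid over \<open>X\<close> containing \<open>R\<close>.\<close>

inductive_set pres_cong :: "'x set \<Rightarrow> ('x list \<times> 'x list) set \<Rightarrow> ('x list \<times> 'x list) set"
  for X :: "'x set" and R :: "('x list \<times> 'x list) set" where
  base: "(u, v) \<in> R \<Longrightarrow> (u, v) \<in> pres_cong X R"
| refl: "u \<in> lists X \<Longrightarrow> (u, u) \<in> pres_cong X R"
| sym: "(u, v) \<in> pres_cong X R \<Longrightarrow> (v, u) \<in> pres_cong X R"
| trans: "(u, v) \<in> pres_cong X R \<Longrightarrow> (v, w) \<in> pres_cong X R \<Longrightarrow> (u, w) \<in> pres_cong X R"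
| mult: "(u, u') \<in> pres_cong X R \<Longrightarrow> (v, v') \<in> pres_cong X R
    \<Longrightarrow> (u @ v, u' @ v') \<in> pres_cong X R"

definition presented_monoid :: "'x set \<Rightarrow> ('x list \<times> 'x list) set \<Rightarrow> 'x list set monoid" where
  "presented_monoid X R =
    \<lparr>carrier = lists X // pres_cong X R,
     mult = (\<lambda>U V. \<Union>u\<in>U. \<Union>v\<in>V. pres_cong X R `` {u @ v}),
     one = pres_cong X R `` {[]}\<rparr>"

lemma equiv_pres_cong:
  assumes "R \<subseteq> lists X \<times> lists X"
  shows "equiv (lists X) (pres_cong X R)"
proof (rule equivI)
  have "u \<in> lists X \<and> v \<in> lists X" if "(u, v) \<in> pres_cong X R" for u v
    using that by induction (use assms in auto)
  then show "pres_cong X R \<subseteq> lists X \<times> lists X" by (simp add: subset_iff)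
  show "refl_on (lists X) (pres_cong X R)"
    by (simp add: refl_on_def pres_cong.refl)
  show "sym (pres_cong X R)" by (auto intro: symI pres_cong.sym)
  show "trans (pres_cong X R)" by (auto intro: transI pres_cong.trans)
qed

lemma presented_monoid_mult_class:
  assumes "R \<subseteq> lists X \<times> lists X" "u \<in> lists X" "v \<in> lists X"
  shows "pres_cong X R `` {u} \<otimes>\<^bsub>presented_monoid X R\<^esub> pres_cong X R `` {v}
    = pres_cong X R `` {u @ v}"
proof -
  note eq = equiv_pres_cong[OF assms(1)]
  have "congruent2 (pres_cong X R) (pres_cong X R) (\<lambda>u v. pres_cong X R `` {u @ v})"
    by (auto simp: congruent2_def intro!: equiv_class_eq[OF eq] pres_cong.mult)
  from UN_equiv_class2[OF eq eq this assms(2,3)] show ?thesis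
    by (simp add: presented_monoid_def)
qed

lemma monoid_presented_monoid:
  assumes "R \<subseteq> lists X \<times> lists X"
  shows "monoid (presented_monoid X R)"
proof -
  have carr: "\<And>U. U \<in> carrier (presented_monoid X R)
      \<longleftrightarrow> (\<exists>u\<in>lists X. U = pres_cong X R `` {u})"
    by (auto simp: presented_monoid_def quotient_def)
  have one: "\<one>\<^bsub>presented_monoid X R\<^esub> = pres_cong X R `` {[]}"
    by (simp add: presented_monoid_def)
  note m = presented_monoid_mult_class[OF assms]
  have app: "\<And>u v. u \<in> lists X \<Longrightarrow> v \<in> lists X \<Longrightarrow> u @ v \<in> lists X" by auto
  have nil: "[] \<in> lists X" by simp
  show ?thesis
  proof (rule monoidI)
    fix U V
    assume "U \<in> carrier (presented_monoid X R)" "V \<in> carrier (presented_monoid X R)"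
    then obtain u v where "u \<in> lists X" "v \<in> lists X"
        "U = pres_cong X R `` {u}" "V = pres_cong X R `` {v}"
      unfolding carr by blast
    then show "U \<otimes>\<^bsub>presented_monoid X R\<^esub> V \<in> carrier (presented_monoid X R)"
      using m app unfolding carr by metis
  next
    show "\<one>\<^bsub>presented_monoid X R\<^esub> \<in> carrier (presented_monoid X R)"
      unfolding carr one using nil by blast
  next
    fix U V W
    assume "U \<in> carrier (presented_monoid X R)" "V \<in> carrier (presented_monoid X R)"
      "W \<in> carrier (presented_monoid X R)"
    then obtain u v w where "u \<in> lists X" "v \<in> lists X" "w \<in> lists X"
        "U = pres_cong X R `` {u}" "V = pres_cong X R `` {v}" "W = pres_cong X R `` {w}"
      unfolding carr by blast
    then show "(U \<otimes>\<^bsub>presented_monoid X R\<^esub> V) \<otimes>\<^bsub>presented_monoid X R\<^esub> W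
        = U \<otimes>\<^bsub>presented_monoid X R\<^esub> (V \<otimes>\<^bsub>presented_monoid X R\<^esub> W)"
      using m app append_assoc by metis
  next
    fix U
    assume "U \<in> carrier (presented_monoid X R)"
    then obtain u where u: "u \<in> lists X" "U = pres_cong X R `` {u}"
      unfolding carr by blast
    show "\<one>\<^bsub>presented_monoid X R\<^esub> \<otimes>\<^bsub>presented_monoid X R\<^esub> U = U"
      using m[OF nil u(1)] u(2) one by simp
    show "U \<otimes>\<^bsub>presented_monoid X R\<^esub> \<one>\<^bsub>presented_monoid X R\<^esub> = U"
      using m[OF u(1) nil] u(2) one by simp
  qed
qed

datatype letter = La | Lb | Lc | Ld | LA nat | LB nat | LC nat | LD nat

definition X_alph :: "nat \<Rightarrow> letter set" where
  "X_alph n = {La, Lb, Lc, Ld} \<union> LA ` {1..n} \<union> LB ` {1..n} \<union> LC ` {1..n} \<union> LD ` {1..n}"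

definition rho :: "nat \<Rightarrow> (letter list \<times> letter list) set" where
  "rho n =
     {([Ld, La], [LA 1, LC 1])}
   \<union> {([LA i, LD i], [LA (i + 1), LC (i + 1)]) | i. 1 \<le> i \<and> i + 1 \<le> n}
   \<union> {([LA n, LD n], [Ld, Lb])}
   \<union> {([Lc, Lb], [LB n, LD n])}
   \<union> {([LB i, LC i], [LB (i - 1), LD (i - 1)]) | i. 2 \<le> i \<and> i \<le> n}"

lemma rho_words: "n \<ge> 1 \<Longrightarrow> rho n \<subseteq> lists (X_alph n) \<times> lists (X_alph n)"
  by (auto simp: rho_def X_alph_def image_iff Bex_def; presburger)

definition M_mon :: "nat \<Rightarrow> letter list set monoid" where
  "M_mon n = presented_monoid (X_alph n) (rho n)"

end

theory Submission
  imports Defs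
begin

text \<open>The alphabet splits into left letters (\<open>c\<close>, \<open>d\<close>, \<open>A\<^sub>i\<close>, \<open>B\<^sub>i\<close>) and right letters
  (\<open>a\<close>, \<open>b\<close>, \<open>C\<^sub>i\<close>, \<open>D\<^sub>i\<close>), and both sides of every defining relation consist of a left letter
  followed by a right letter. Two such factors of one word never overlap, and applying a relation
  does not change which positions carry left letters. So two words are equal in the monoid exactly
  if they have the same factors of this kind at the same positions up to the relations
  generated on two-letter words, and the same letters everywhere else; this is the predicate
  \<open>agree\<close>, identified with the congruence by \<open>cong_iff_agree\<close>.

  Under this description, cancelling a letter at an end of a word can only affect the factor it
  belongs to. Cancellation therefore reduces to a condition on two-letter words: two equal
  left-right factors that share one letter are identical. In \<open>\<M>\<^sub>n\<close> no left-right factor occurs in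
  two relations, so a factor equals at most one other factor, and the two sides of each
  relation differ in both letters.\<close>

section \<open>Presentations by relations between left-right factors\<close>

locale left_right_presentation =
  fixes X :: "'x set" and R :: "('x list \<times> 'x list) set" and left :: "'x \<Rightarrow> bool"
  assumes R_words: "R \<subseteq> lists X \<times> lists X"
    and R_left_right: "(u, v) \<in> R \<Longrightarrow>
      \<exists>x y p q. u = [x, y] \<and> v = [p, q] \<and> left x \<and> \<not> left y \<and> left p \<and> \<not> left q"
begin

abbreviation cong :: "('x list \<times> 'x list) set" where
  "cong \<equiv> pres_cong X R"

definition factor_eq :: "('x list \<times> 'x list) set" where
  "factor_eq = (R \<union> R\<inverse>)\<^sup>*"

lemma factor_eq_refl [simp]: "(u, u) \<in> factor_eq"
  by (simp add: factor_eq_def)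

lemma factor_eq_trans: "(u, v) \<in> factor_eq \<Longrightarrow> (v, w) \<in> factor_eq \<Longrightarrow> (u, w) \<in> factor_eq"
  unfolding factor_eq_def by (rule rtrancl_trans)

lemma factor_eq_sym: "(u, v) \<in> factor_eq \<Longrightarrow> (v, u) \<in> factor_eq"
  unfolding factor_eq_def by (rule symD[OF sym_rtrancl]) (auto simp: sym_def)

lemma factor_eq_left_right:
  assumes "([x, y], [p, q]) \<in> factor_eq" "left x" "\<not> left y"
  shows "left p \<and> \<not> left q"
proof -
  have "\<exists>p q. w = [p, q] \<and> left p \<and> \<not> left q" if "([x, y], w) \<in> (R \<union> R\<inverse>)\<^sup>*" for w
    using that by induction (use assms(2,3) in \<open>auto dest!: R_left_right\<close>)
  then show ?thesis
    using assms(1) unfolding factor_eq_def by fastforce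
qed

lemma factor_eq_cong:
  assumes "(u, v) \<in> factor_eq" "u \<in> lists X"
  shows "(u, v) \<in> cong"
  using assms(1) unfolding factor_eq_def
proof induction
  case base
  show ?case using assms(2) by (rule pres_cong.refl)
next
  case (step v w)
  then have "(v, w) \<in> cong" by (auto intro: pres_cong.base pres_cong.sym)
  with step.IH show ?case by (rule pres_cong.trans)
qed

fun agree :: "'x list \<Rightarrow> 'x list \<Rightarrow> bool" where
  "agree (x # y # u) (p # q # v) =
    (if left x \<and> \<not> left y then ([x, y], [p, q]) \<in> factor_eq \<and> agree u v
     else x = p \<and> agree (y # u) (q # v))"
| "agree u v = (u = v \<and> length u < 2)"

lemma agree_length: "agree u v \<Longrightarrow> length u = length v"
  by (induction u v rule: agree.induct) (auto split: if_splits)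

lemma agree_refl: "agree u u"
  by (induction u rule: induct_list012) auto

text \<open>A right letter at the front of a word cannot be the second letter of a left-right factor, so
  it is unaffected by every relation.\<close>

lemma agree_right_letter:
  assumes "agree (y # u) (q # v)" "\<not> left y"
  shows "y = q \<and> agree u v"
  using assms by (cases u; cases v) auto

text \<open>An additional first letter can merge only with a right letter, and those are equal in
  agreeing words.\<close>

lemma agree_Cons:
  assumes "agree u v"
  shows "agree (x # u) (x # v)"
proof (cases u)
  case Nil
  then show ?thesis using agree_length[OF assms] by simp
next
  case (Cons y u')
  then obtain q v' where v: "v = q # v'"
    using agree_length[OF assms] by (cases v) auto
  show ?thesis
    using assms agree_right_letter[of y u' q v'] unfolding Cons v by auto
qed

lemma agree_append:
  assumes "agree u u'" "agree v v'"
  shows "agree (u @ v) (u' @ v')"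
  using assms
proof (induction u u' rule: agree.induct)
  case (1 x y u p q v)
  then show ?case by (auto split: if_splits)
qed (auto intro: agree_Cons simp: less_2_cases_iff length_Suc_conv)

lemma agree_hd_left:
  assumes "agree (y # u) (q # v)"
  shows "left y = left q"
proof (cases "\<exists>y' u'. u = y' # u' \<and> left y \<and> \<not> left y'")
  case True
  then obtain y' u' where u: "u = y' # u'" "left y" "\<not> left y'" by blast
  with assms obtain q' v' where "v = q' # v'"
    using agree_length[OF assms] by (cases v) auto
  with assms u show ?thesis using factor_eq_left_right[of y y' q q'] by auto
next
  case False
  with assms show ?thesis by (cases u; cases v) (auto split: if_splits)
qed

lemma agree_sym: "agree u v \<Longrightarrow> agree v u"
proof (induction u v rule: agree.induct)
  case (1 x y u p q v)
  show ?case
  proof (cases "left x \<and> \<not> left y")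
    case True
    with 1 show ?thesis using factor_eq_left_right[of x y p q] factor_eq_sym by auto
  next
    case False
    with 1 show ?thesis using agree_hd_left[of y u q v] by auto
  qed
qed auto

lemma agree_trans: "agree u v \<Longrightarrow> agree v w \<Longrightarrow> agree u w"
proof (induction u v arbitrary: w rule: agree.induct)
  case (1 x y u p q v)
  obtain r s w' where w: "w = r # s # w'"
    using agree_length[OF "1.prems"(2)] by (cases w; cases "tl w") auto
  show ?case
  proof (cases "left x \<and> \<not> left y")
    case True
    with "1.prems" have pq: "([x, y], [p, q]) \<in> factor_eq" "left p \<and> \<not> left q" and "agree u v"
      using factor_eq_left_right[of x y p q] by auto
    with "1.prems"(2) have rs: "([p, q], [r, s]) \<in> factor_eq" and "agree v w'"
      unfolding w by auto
    then have "agree u w'" using "1.IH"(1)[OF True] \<open>agree u v\<close> by blast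
    with True factor_eq_trans[OF pq(1) rs] show ?thesis unfolding w by simp
  next
    case False
    with "1.prems" have "x = p" and yq: "agree (y # u) (q # v)" by (auto split: if_splits)
    with "1.prems"(2) False agree_hd_left[OF yq] have "p = r" and "agree (q # v) (s # w')"
      unfolding w by (auto split: if_splits)
    then have "agree (y # u) (s # w')" using "1.IH"(2)[OF False] yq by blast
    with False \<open>x = p\<close> \<open>p = r\<close> show ?thesis unfolding w by auto
  qed
qed auto

lemma cong_agree: "(u, v) \<in> cong \<Longrightarrow> agree u v"
proof (induction rule: pres_cong.induct)
  case (base u v)
  then have "(u, v) \<in> factor_eq" by (auto simp: factor_eq_def)
  with R_left_right[OF base] show ?case by auto
next
  case (trans u v w)
  from trans.IH show ?case by (rule agree_trans)
qed (simp_all add: agree_refl agree_sym agree_append)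

lemma agree_cong:
  assumes "agree u v" "u \<in> lists X"
  shows "(u, v) \<in> cong"
  using assms
proof (induction u v rule: agree.induct)
  case (1 x y u p q v)
  show ?case
  proof (cases "left x \<and> \<not> left y")
    case True
    with 1 have "([x, y], [p, q]) \<in> cong" "(u, v) \<in> cong"
      by (auto intro: factor_eq_cong)
    from pres_cong.mult[OF this] show ?thesis by simp
  next
    case False
    with 1 have "([x], [p]) \<in> cong" "(y # u, q # v) \<in> cong"
      by (auto intro: pres_cong.refl)
    from pres_cong.mult[OF this] show ?thesis by simp
  qed
qed (auto intro: pres_cong.refl)

lemma cong_iff_agree: "u \<in> lists X \<Longrightarrow> (u, v) \<in> cong \<longleftrightarrow> agree u v"
  using cong_agree agree_cong by blast

end

section \<open>Cancellation\<close>

text \<open>The two conditions say that cancellation holds for equal left-right factors; they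
  are the instances of cancellation in which a whole word is such a factor.\<close>

locale factor_cancellative_presentation = left_right_presentation +
  assumes factor_cancel_left: "left x \<Longrightarrow> ([x, y], [x, q]) \<in> factor_eq \<Longrightarrow> y = q"
    and factor_cancel_right: "\<not> left y \<Longrightarrow> ([x, y], [p, y]) \<in> factor_eq \<Longrightarrow> x = p"
begin

lemma agree_Cons_cancel:
  assumes "agree (x # u) (x # v)"
  shows "agree u v"
  using assms
  by (cases u; cases v) (auto split: if_splits dest: factor_cancel_left intro: agree_Cons)

lemma agree_append_cancel_left: "agree (w @ u) (w @ v) \<Longrightarrow> agree u v"
  by (induction w) (auto dest: agree_Cons_cancel)

lemma agree_snoc_cancel:
  assumes "agree (u @ [z]) (v @ [z])"
  shows "agree u v"
proof -
  have "length u = length v"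
    using agree_length[OF assms] by simp
  then show ?thesis
    using assms
  proof (induction u v rule: agree.induct)
    case (1 x y u p q v)
    then show ?case by (auto split: if_splits)
  qed (auto split: if_splits dest: factor_cancel_right simp: length_Suc_conv Suc_length_conv)
qed

lemma agree_append_cancel_right: "agree (u @ w) (v @ w) \<Longrightarrow> agree u v"
proof (induction w rule: rev_induct)
  case (snoc z w)
  then show ?case using agree_snoc_cancel[of "u @ w" z "v @ w"] by simp
qed simp

theorem monoid_cancel_presented_monoid: "monoid_cancel (presented_monoid X R)"
proof -
  let ?M = "presented_monoid X R"
  note eq = equiv_pres_cong[OF R_words]
  have class_word: "\<exists>u\<in>lists X. U = cong `` {u}" if "U \<in> carrier ?M" for U
    using that by (auto simp: presented_monoid_def quotient_def)
  have product_eq: "cong `` {u} \<otimes>\<^bsub>?M\<^esub> cong `` {v} = cong `` {u'} \<otimes>\<^bsub>?M\<^esub> cong `` {v'}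
      \<longleftrightarrow> agree (u @ v) (u' @ v')"
    if "u \<in> lists X" "v \<in> lists X" "u' \<in> lists X" "v' \<in> lists X" for u v u' v'
    using that
    by (simp add: presented_monoid_mult_class[OF R_words] eq_equiv_class_iff[OF eq] cong_iff_agree)
  have class_eq: "cong `` {u} = cong `` {v}"
    if "u \<in> lists X" "v \<in> lists X" "agree u v" for u v
    using that by (simp add: eq_equiv_class_iff[OF eq] cong_iff_agree)
  interpret monoid ?M
    using R_words by (rule monoid_presented_monoid)
  show ?thesis
  proof
    fix W U V
    assume *: "W \<otimes>\<^bsub>?M\<^esub> U = W \<otimes>\<^bsub>?M\<^esub> V"
      and carr: "U \<in> carrier ?M" "V \<in> carrier ?M" "W \<in> carrier ?M"
    obtain u where u: "u \<in> lists X" "U = cong `` {u}"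
      using class_word[OF carr(1)] by (rule bexE)
    obtain v where v: "v \<in> lists X" "V = cong `` {v}"
      using class_word[OF carr(2)] by (rule bexE)
    obtain w where w: "w \<in> lists X" "W = cong `` {w}"
      using class_word[OF carr(3)] by (rule bexE)
    from * have "agree (w @ u) (w @ v)"
      using u v w by (simp add: product_eq)
    then show "U = V"
      using u v class_eq agree_append_cancel_left by simp
  next
    fix W U V
    assume *: "U \<otimes>\<^bsub>?M\<^esub> W = V \<otimes>\<^bsub>?M\<^esub> W"
      and carr: "U \<in> carrier ?M" "V \<in> carrier ?M" "W \<in> carrier ?M"
    obtain u where u: "u \<in> lists X" "U = cong `` {u}"
      using class_word[OF carr(1)] by (rule bexE)
    obtain v where v: "v \<in> lists X" "V = cong `` {v}"
      using class_word[OF carr(2)] by (rule bexE)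
    obtain w where w: "w \<in> lists X" "W = cong `` {w}"
      using class_word[OF carr(3)] by (rule bexE)
    from * have "agree (u @ w) (v @ w)"
      using u v w by (simp add: product_eq)
    then show "U = V"
      using u v class_eq agree_append_cancel_right by simp
  qed
qed

end

section \<open>The monoids \<open>\<M>\<^sub>n\<close>\<close>

fun left_letter :: "letter \<Rightarrow> bool" where
  "left_letter Lc = True"
| "left_letter Ld = True"
| "left_letter (LA i) = True"
| "left_letter (LB i) = True"
| "left_letter x = False"

text \<open>No two-letter word occurs in two relations, so there are no nontrivial chains
  of relations between two-letter words.\<close>

lemma rho_rtrancl:
  assumes "(u, v) \<in> (rho n \<union> (rho n)\<inverse>)\<^sup>*"
  shows "u = v \<or> (u, v) \<in> rho n \<or> (v, u) \<in> rho n"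
proof -
  have one_lhs: "u = w" if "(u, v) \<in> rho n" "(w, v) \<in> rho n" for u v w
    using that by (auto simp: rho_def)
  have one_rhs: "v = w" if "(u, v) \<in> rho n" "(u, w) \<in> rho n" for u v w
    using that by (auto simp: rho_def)
  have no_chain: "(v, w) \<notin> rho n" if "(u, v) \<in> rho n" for u v w
    using that by (auto simp: rho_def)
  from assms show ?thesis
    by induction (auto dest: one_lhs one_rhs no_chain)
qed

lemma rho_differ:
  assumes "([x, y], [p, q]) \<in> rho n"
  shows "x \<noteq> p \<and> y \<noteq> q"
  using assms by (auto simp: rho_def)

theorem proposition3p2:
  fixes n :: nat
  assumes "n \<ge> 1"
  shows "monoid_cancel (M_mon n)"
proof -
  interpret left_right_presentation "X_alph n" "rho n" left_letter
    by unfold_locales (use rho_words[OF assms] in \<open>auto simp: rho_def\<close>)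
  interpret factor_cancellative_presentation "X_alph n" "rho n" left_letter
    by unfold_locales (auto simp: factor_eq_def dest!: rho_rtrancl dest: rho_differ)
  show ?thesis
    unfolding M_mon_def by (rule monoid_cancel_presented_monoid)
qed

end
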